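(* Let $\mathcal X$ be a Polish space, $\mu\in\mathcal P(\mathcal X)$, and let $\chi$ be a nonnegative measurable function on $\mathcal X$ such that $\int_{\mathcal X}e^{a_o\chi}\,d\mu<\infty$ for some $a_o>0$. Then $\|\chi\|_\rho<\infty$, and for any probability measure $\nu$ which is absolutely continuous with respect to $\mu$ and such that $\frac{d\nu}{d\mu}\in L_{\rho^*}(\mu)$, the quantity $\|\chi\cdot(\nu-\mu)\|_{\mathrm{TV}}$ is well defined, finite, and $$\|\chi\cdot(\nu-\mu)\|_{\mathrm{TV}}\le\|\chi\|_\rho\left(2\sqrt{H(\nu\mid\mu)}+H(\nu\mid\mu)\right).$$
   Context: $\mathcal P(\mathcal X)$ is the set of Borel probability measures on $\mathcal X$. $H(\nu\mid\mu)=\int\log\frac{d\nu}{d\mu}\,d\nu$ if $\nu\ll\mu$ and $+\infty$ otherwise. $\rho(s)=e^{|s|}-1$ and $\|\varphi\|_\rho=\inf\{b>0:\int\rho(\varphi/b)\,d\mu\le1\}=\inf\{b>0:\int e^{|\varphi|/b}\,d\mu\le2\}$. $\rho^*(t)=|t|\log|t|-|t|+1$ if $|t|\ge1$ and $0$ if $|t|\le1$; $L_{\rho^*}(\mu)$ is the set of measurable $\eta:\mathcal X\to\mathbb R$ with $\int\rho^*(a\eta)\,d\mu<\infty$ for some $a>0$. The total variation norm of a signed measure $\xi$ is $\|\xi\|_{\mathrm{TV}}=\sup\{\int\varphi\,d\xi:\varphi\text{ measurable},\ \sup|\varphi|\le1\}$; thus $\|\chi\cdot(\nu-\mu)\|_{\mathrm{TV}}=\sup\{\int\chi\psi\,d(\nu-\mu):\psi\text{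 measurable},\ \sup|\psi|\le1\}$. *)

theory Defs
  imports "HOL-Probability.Probability"
begin

text \<open>
  All quantities that may be infinite take values in \<^typ>\<open>ereal\<close>.  A Borel probability measure
  on a type is a measure \<open>\<mu>\<close> with \<open>prob_space \<mu>\<close> and \<open>sets \<mu> = sets borel\<close>.
\<close>

text \<open>The Bochner integral is \<open>0\<close> on non-integrable functions, so the integral defining the
  relative entropy is taken as positive part minus negative part.  Coercion by \<^const>\<open>ennreal\<close>
  sends negative reals to \<open>0\<close>.\<close>

definition ext_integral :: "'a measure \<Rightarrow> ('a \<Rightarrow> real) \<Rightarrow> ereal" where
  "ext_integral M f =
     enn2ereal (\<integral>\<^sup>+ x. ennreal (f x) \<partial>M) - enn2ereal (\<integral>\<^sup>+ x. ennreal (- f x) \<partial>M)"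

text \<open>\<^const>\<open>RN_deriv\<close> takes the dominating measure first and has values in \<^typ>\<open>ennreal\<close>; for finite
  measures it is finite almost everywhere.\<close>

definition density_of :: "'a measure \<Rightarrow> 'a measure \<Rightarrow> 'a \<Rightarrow> real" where
  "density_of \<nu> \<mu> = (\<lambda>x. enn2real (RN_deriv \<mu> \<nu> x))"

definition rel_entropy :: "'a measure \<Rightarrow> 'a measure \<Rightarrow> ereal" where
  "rel_entropy \<nu> \<mu> =
     (if absolutely_continuous \<mu> \<nu> then ext_integral \<nu> (\<lambda>x. ln (density_of \<nu> \<mu> x)) else \<infinity>)"

definition rho :: "real \<Rightarrow> real" where
  "rho s = exp \<bar>s\<bar> - 1"

definition rho_star :: "real \<Rightarrow> real" where
  "rho_star t = (if \<bar>t\<bar> \<ge> 1 then \<bar>t\<bar> * ln \<bar>t\<bar> - \<bar>t\<bar> + 1 else 0)"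

text \<open>The infimum of the empty set is \<open>\<infinity>\<close>.\<close>

definition rho_norm :: "'a measure \<Rightarrow> ('a \<Rightarrow> real) \<Rightarrow> ereal" where
  "rho_norm \<mu> \<phi> = (INF b \<in> {b::real. 0 < b \<and> (\<integral>\<^sup>+ x. ennreal (rho (\<phi> x / b)) \<partial>\<mu>) \<le> 1}. ereal b)"

definition L_rho_star :: "'a measure \<Rightarrow> ('a \<Rightarrow> real) set" where
  "L_rho_star \<mu> = {\<eta> \<in> borel_measurable \<mu>.
     \<exists>a>0. (\<integral>\<^sup>+ x. ennreal (rho_star (a * \<eta> x)) \<partial>\<mu>) < \<infinity>}"

definition unit_test_functions :: "('a::topological_space \<Rightarrow> real) set" where
  "unit_test_functions = {\<psi> \<in> borel_measurable borel. \<forall>x. \<bar>\<psi> x\<bar> \<le> 1}"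

text \<open>The total variation norm of the weighted difference \<open>chi \<cdot> (\<nu> - \<mu>)\<close>.  The integral of
  \<open>chi \<psi>\<close> against \<open>\<nu> - \<mu>\<close> is the difference of the two integrals; the supremum is meaningful only if
  all of these exist, which is what \<open>weighted_tv_well_defined\<close> says.\<close>

definition weighted_tv_well_defined ::
    "('a::topological_space \<Rightarrow> real) \<Rightarrow> 'a measure \<Rightarrow> 'a measure \<Rightarrow> bool" where
  "weighted_tv_well_defined chi \<nu> \<mu> \<longleftrightarrow>
     (\<forall>\<psi>\<in>unit_test_functions.
        integrable \<nu> (\<lambda>x. chi x * \<psi> x) \<and> integrable \<mu> (\<lambda>x. chi x * \<psi> x))"

definition weighted_tv_norm ::
    "('a::topological_space \<Rightarrow> real) \<Rightarrow> 'a measure \<Rightarrow> 'a measure \<Rightarrow> ereal" where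
  "weighted_tv_norm chi \<nu> \<mu> =
     (SUP \<psi>\<in>unit_test_functions. ereal ((\<integral>x. chi x * \<psi> x \<partial>\<nu>) - (\<integral>x. chi x * \<psi> x \<partial>\<mu>)))"

definition ereal_sqrt :: "ereal \<Rightarrow> ereal" where
  "ereal_sqrt x = (if x = \<infinity> then \<infinity> else ereal (sqrt (real_of_ereal x)))"

end

theory Submission
  imports Defs
begin

text \<open>
  The inequality comes from the Gibbs variational principle. Let \<open>f\<close> be the density of \<open>\<nu>\<close>, let \<open>H\<close> be
  the relative entropy, let \<open>b\<close> be admissible in the infimum that defines the Luxemburg norm of
  \<open>chi\<close>, and put \<open>y = chi * \<psi> / b\<close> for a test function \<open>\<psi>\<close>. Convex duality between \<open>t ln t - t\<close> and
  the exponential gives \<open>f * (s * y) \<le> f * ln f - f + exp (s * y)\<close> pointwise. Integrating against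
  \<open>\<mu>\<close> bounds \<open>s \<integral>y d\<nu>\<close> by \<open>H + \<integral>(exp (s * y) - 1) d\<mu>\<close>.

  For \<open>0 \<le> s \<le> 1\<close> every term of order at least two in the exponential series carries a factor
  \<open>s\<^sup>2\<close>, so \<open>exp (s * y) - 1 - s * y \<le> s\<^sup>2 * (exp \<bar>y\<bar> - 1)\<close>, and the last bracket integrates to at
  most \<open>1\<close> because \<open>\<bar>y\<bar> \<le> chi / b\<close>. Hence \<open>s * (\<integral>y d\<nu> - \<integral>y d\<mu>) \<le> H + s\<^sup>2\<close>, and choosing \<open>s\<close>
  well turns this into the bound \<open>2 * sqrt H + H\<close>. Multiplying by \<open>b\<close>, taking the supremum over
  \<open>\<psi>\<close> and the infimum over \<open>b\<close> yields the claim. The same duality with \<open>s * y\<close> replaced by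
  \<open>chi / b\<close> shows that \<open>chi\<close> is \<open>\<nu>\<close>-integrable.

  The hypothesis on \<open>f\<close> makes \<open>f * ln f\<close> integrable, so \<open>H\<close> is an honest real number. The norm of
  \<open>chi\<close> is finite because convexity of the exponential lets \<open>\<integral>(exp (t * a * chi) - 1) d\<mu>\<close> shrink
  linearly in \<open>t\<close>.
\<close>

section \<open>Elementary inequalities\<close>

text \<open>The Fenchel-Young inequality for the conjugate pair \<open>f ln f - f\<close> and \<open>exp u\<close>. For \<open>f > 0\<close> it is
  the tangent line bound \<open>1 + z \<le> exp z\<close> at \<open>z = u - ln f\<close>. The instance \<open>u = 0\<close> gives the lower bound
  \<open>f - 1 \<le> f * ln f\<close>.\<close>

lemma young_entropy_exp:
  fixes f u :: real
  assumes "0 \<le> f"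
  shows "f * u \<le> f * ln f - f + exp u"
proof (cases "f = 0")
  case False
  then have f: "f > 0" using assms by simp
  have "f * (1 + (u - ln f)) \<le> f * exp (u - ln f)"
    using f exp_ge_add_one_self[of "u - ln f"] by (intro mult_left_mono) auto
  also have "\<dots> = exp u" using f by (simp add: exp_diff)
  finally show ?thesis by (simp add: algebra_simps)
qed simp

text \<open>Compare the power series from the quadratic term on: \<open>s ^ (n + 2) \<le> s\<^sup>2\<close> for \<open>s\<close> in the unit
  interval. The term \<open>\<bar>y\<bar>\<close> dropped at the end leaves exactly the function \<open>rho\<close> on the right.\<close>

lemma exp_remainder_scaling:
  fixes s y :: real
  assumes "0 \<le> s" "s \<le> 1"
  shows "exp (s * y) - 1 - s * y \<le> s\<^sup>2 * (exp \<bar>y\<bar> - 1)"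
proof -
  let ?r = "\<lambda>z n. inverse (fact (n + 2)) *\<^sub>R (z :: real) ^ (n + 2)"
  have summ: "summable (?r z)" for z
    using summable_exp_generic[of z] by (subst summable_iff_shift) (simp add: scaleR_conv_of_real)
  have "exp (s * y) - 1 - s * y = (\<Sum>n. ?r (s * y) n)"
    using exp_first_two_terms[of "s * y"] by simp
  also have "\<dots> \<le> (\<Sum>n. s\<^sup>2 * ?r \<bar>y\<bar> n)"
  proof (intro suminf_le summable_mult summ)
    fix n
    have "(s * y) ^ (n + 2) \<le> \<bar>s * y\<bar> ^ (n + 2)"
      by (metis abs_ge_self power_abs)
    also have "\<dots> = s\<^sup>2 * (s ^ n * \<bar>y\<bar> ^ (n + 2))"
      using assms by (simp add: abs_mult power_mult_distrib power_add power2_eq_square)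
    also have "\<dots> \<le> s\<^sup>2 * (1 * \<bar>y\<bar> ^ (n + 2))"
      using assms by (intro mult_left_mono mult_right_mono power_le_one) auto
    finally have "(s * y) ^ (n + 2) \<le> s\<^sup>2 * \<bar>y\<bar> ^ (n + 2)" by simp
    then have "inverse (fact (n + 2)) * (s * y) ^ (n + 2)
        \<le> inverse (fact (n + 2)) * (s\<^sup>2 * \<bar>y\<bar> ^ (n + 2))"
      by (intro mult_left_mono) auto
    then show "?r (s * y) n \<le> s\<^sup>2 * ?r \<bar>y\<bar> n"
      by (simp only: real_scaleR_def mult.left_commute)
  qed
  also have "\<dots> = s\<^sup>2 * (exp \<bar>y\<bar> - 1 - \<bar>y\<bar>)"
    using exp_first_two_terms[of "\<bar>y\<bar>"] summ[of "\<bar>y\<bar>"] by (simp add: suminf_mult)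
  also have "\<dots> \<le> s\<^sup>2 * (exp \<bar>y\<bar> - 1)"
    by (intro mult_left_mono) auto
  finally show ?thesis .
qed

text \<open>Convexity of \<open>exp\<close> on the segment from \<open>0\<close> to \<open>u\<close>.\<close>

lemma exp_minus_one_scaling:
  fixes t u :: real
  assumes "0 \<le> t" "t \<le> 1"
  shows "exp (t * u) - 1 \<le> t * (exp u - 1)"
proof -
  have "exp ((1 - t) *\<^sub>R 0 + t *\<^sub>R u) \<le> (1 - t) * exp 0 + t * exp u"
    using assms by (intro convex_onD[OF exp_convex]) auto
  then show ?thesis by (simp add: algebra_simps)
qed

text \<open>The sum \<open>H / s + s\<close> is smallest at \<open>s = sqrt H\<close>, with value \<open>2 * sqrt H\<close>, but this choice is
  available only if \<open>H \<le> 1\<close>. Beyond that, \<open>s = 1\<close> gives \<open>H + 1\<close>, which is where the linear term \<open>H\<close>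
  in the conclusion enters.\<close>

lemma optimise_scaling_parameter:
  fixes I H :: real
  assumes H: "0 \<le> H" and bound: "\<And>s. 0 < s \<Longrightarrow> s \<le> 1 \<Longrightarrow> s * I \<le> H + s\<^sup>2"
  shows "I \<le> 2 * sqrt H + H"
proof -
  consider "H = 0" | "0 < H" "H \<le> 1" | "1 < H" using H by linarith
  then show ?thesis
  proof cases
    case 1
    \<comment> \<open>The minimiser is not positive here, so \<open>s\<close> tends to \<open>0\<close> instead: any \<open>s < I\<close> is absurd.\<close>
    have "I \<le> 0"
    proof (rule ccontr)
      assume "\<not> I \<le> 0"
      then have s: "0 < min 1 (I / 2)" "min 1 (I / 2) < I" by auto
      have "min 1 (I / 2) * I \<le> min 1 (I / 2) * min 1 (I / 2)"
        using bound[of "min 1 (I / 2)"] s 1 by (simp add: power2_eq_square)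
      then show False using s mult_strict_left_mono[OF s(2) s(1)] by linarith
    qed
    then show ?thesis using 1 by simp
  next
    case 2
    have "sqrt H * I \<le> sqrt H * (2 * sqrt H)"
    proof -
      have "sqrt H * (2 * sqrt H) = H + (sqrt H)\<^sup>2" using H by (simp add: power2_eq_square)
      moreover have "sqrt H * I \<le> H + (sqrt H)\<^sup>2" by (rule bound) (use 2 in auto)
      ultimately show ?thesis by linarith
    qed
    then have "I \<le> 2 * sqrt H" by (rule mult_left_le_imp_le) (use 2 in simp)
    then show ?thesis using 2 by simp
  next
    case 3
    have "I \<le> H + 1" using bound[of 1] by simp
    moreover have "1 \<le> sqrt H" using 3 by simp
    ultimately show ?thesis by linarith
  qed
qed


section \<open>Entropy of a density\<close>

text \<open>The function \<open>f * ln f\<close> differs from \<open>rho_star (a * f) / a\<close> by a multiple of \<open>f\<close> and a constant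
  where \<open>a * f \<ge> 1\<close>; elsewhere \<open>f\<close> is bounded, and so is \<open>f * ln f\<close>.\<close>

lemma L_rho_star_imp_integrable_entropy:
  assumes "prob_space \<mu>" and f0: "\<And>x. 0 \<le> f x" and int: "integrable \<mu> f"
    and L: "f \<in> L_rho_star \<mu>"
  shows "integrable \<mu> (\<lambda>x. f x * ln (f x))"
proof -
  interpret prob_space \<mu> by fact
  have [measurable]: "f \<in> borel_measurable \<mu>" using int by auto
  obtain a where a: "a > 0" and fin: "(\<integral>\<^sup>+ x. ennreal (rho_star (a * f x)) \<partial>\<mu>) < \<infinity>"
    using L unfolding L_rho_star_def by auto
  have rs0: "rho_star t \<ge> 0" for t
    using young_entropy_exp[of "\<bar>t\<bar>" 0] by (simp add: rho_star_def)
  have [measurable]: "(\<lambda>x. rho_star (a * f x)) \<in> borel_measurable \<mu>"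
    unfolding rho_star_def by measurable
  have irs: "integrable \<mu> (\<lambda>x. rho_star (a * f x))"
    using fin rs0 by (intro integrableI_nonneg) auto
  define g where "g x = 1 + rho_star (a * f x) / a + (\<bar>ln a\<bar> + 1) * f x + \<bar>ln a\<bar> / a" for x
  have "integrable \<mu> g" unfolding g_def using irs int by simp
  moreover have "(\<lambda>x. f x * ln (f x)) \<in> borel_measurable \<mu>" by measurable
  moreover have "norm (f x * ln (f x)) \<le> norm (g x)" for x
  proof -
    have lower: "f x * ln (f x) \<ge> f x - 1" using young_entropy_exp[OF f0[of x], of 0] by simp
    have upper: "f x * ln (f x) \<le> rho_star (a * f x) / a + (\<bar>ln a\<bar> + 1) * f x + \<bar>ln a\<bar> / a"
    proof (cases "a * f x \<ge> 1")
      case True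
      then have fp: "f x > 0" using a f0[of x] by (cases "f x = 0") (auto simp: less_le)
      have "rho_star (a * f x) / a = f x * (ln a + ln (f x)) - f x + 1 / a"
        using True a fp by (simp add: rho_star_def ln_mult field_simps)
      then have "f x * ln (f x) = rho_star (a * f x) / a + (- ln a + 1) * f x - 1 / a"
        by (simp add: algebra_simps)
      also have "\<dots> \<le> rho_star (a * f x) / a + (\<bar>ln a\<bar> + 1) * f x + \<bar>ln a\<bar> / a"
      proof -
        have "(- ln a + 1) * f x \<le> (\<bar>ln a\<bar> + 1) * f x"
          using fp by (intro mult_right_mono) auto
        moreover have "- (1 / a) \<le> 0" "0 \<le> \<bar>ln a\<bar> / a" using a by auto
        ultimately show ?thesis by linarith
      qed
      finally show ?thesis .
    next
      case False
      have "f x * ln (f x) \<le> \<bar>ln a\<bar> * f x"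
      proof (cases "f x = 0")
        case False
        then have fp: "f x > 0" using f0[of x] by simp
        have "ln (a * f x) < 0" using \<open>\<not> a * f x \<ge> 1\<close> a fp by simp
        then have "ln (f x) \<le> \<bar>ln a\<bar>" using a fp by (simp add: ln_mult)
        then show ?thesis using fp by (simp add: mult.commute mult_left_mono)
      qed simp
      moreover have "0 \<le> rho_star (a * f x) / a" "0 \<le> \<bar>ln a\<bar> / a" using a rs0 by auto
      ultimately show ?thesis using f0[of x] unfolding distrib_right by linarith
    qed
    have "0 \<le> rho_star (a * f x) / a" "0 \<le> \<bar>ln a\<bar> / a" "0 \<le> (\<bar>ln a\<bar> + 1) * f x"
      using a rs0 f0[of x] by auto
    then show ?thesis
      unfolding g_def real_norm_def using lower upper f0[of x] by linarith
  qed
  ultimately show ?thesis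
    by (rule Bochner_Integration.integrable_bound[of \<mu> g, OF _ _ AE_I2])
qed

lemma ext_integral_eq_integral:
  assumes "integrable M f"
  shows "ext_integral M f = ereal (\<integral>x. f x \<partial>M)"
proof -
  obtain r q where "0 \<le> r" "0 \<le> q" "(\<integral>\<^sup>+x. ennreal (f x) \<partial>M) = ennreal r"
    "(\<integral>\<^sup>+x. ennreal (- f x) \<partial>M) = ennreal q" "(\<integral>x. f x \<partial>M) = r - q"
    using assms by (rule integrableE) auto
  then show ?thesis by (simp add: ext_integral_def enn2ereal_ennreal)
qed

text \<open>Passing from the \<open>ennreal\<close>-valued derivative to a real function changes it only where it is
  infinite, which is a null set since \<open>\<nu>\<close> is finite.\<close>

lemma density_density_of:
  assumes "prob_space \<mu>" "prob_space \<nu>" "sets \<nu> = sets \<mu>" "absolutely_continuous \<mu> \<nu>"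
  shows "density \<mu> (\<lambda>x. ennreal (density_of \<nu> \<mu> x)) = \<nu>"
proof -
  interpret M: prob_space \<mu> by fact
  interpret N: prob_space \<nu> by fact
  have "AE x in \<mu>. RN_deriv \<mu> \<nu> x \<noteq> \<infinity>"
    using assms N.sigma_finite_measure_axioms by (intro M.RN_deriv_finite) auto
  then have "AE x in \<mu>. ennreal (density_of \<nu> \<mu> x) = RN_deriv \<mu> \<nu> x"
    by eventually_elim (simp add: density_of_def less_top)
  then have "density \<mu> (\<lambda>x. ennreal (density_of \<nu> \<mu> x)) = density \<mu> (RN_deriv \<mu> \<nu>)"
    by (intro density_cong) (auto simp: density_of_def)
  then show ?thesis using M.density_RN_deriv[of \<nu>] assms by simp
qed


section \<open>Entropy bound for differences of integrals\<close>

text \<open>Young's inequality bounds the \<open>\<nu>\<close>-integral of \<open>s * y\<close> by the entropy plus the \<open>\<mu>\<close>-integral of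
  \<open>exp (s * y) - 1\<close>, and the quadratic remainder estimate replaces the latter by \<open>s * y\<close> up to
  \<open>s\<^sup>2\<close>. The factor in front of \<open>s\<^sup>2\<close> is the integral of \<open>rho w\<close>, hence at most \<open>1\<close>.\<close>

lemma integral_difference_le_entropy:
  assumes "prob_space \<mu>" and f0: "\<And>x. 0 \<le> f x" and [measurable]: "f \<in> borel_measurable \<mu>"
    and \<nu>: "prob_space (density \<mu> f)"
    and ent: "integrable \<mu> (\<lambda>x. f x * ln (f x))"
    and [measurable]: "w \<in> borel_measurable \<mu>" "y \<in> borel_measurable \<mu>"
    and yw: "\<And>x. \<bar>y x\<bar> \<le> w x"
    and w: "(\<integral>\<^sup>+ x. ennreal (rho (w x)) \<partial>\<mu>) \<le> 1"
  shows "integrable \<mu> y" "integrable (density \<mu> f) y"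
    and "(\<integral>x. y x \<partial>density \<mu> f) - (\<integral>x. y x \<partial>\<mu>)
      \<le> 2 * sqrt (\<integral>x. f x * ln (f x) \<partial>\<mu>) + (\<integral>x. f x * ln (f x) \<partial>\<mu>)"
proof -
  interpret M: prob_space \<mu> by fact
  interpret N: prob_space "density \<mu> f" by fact
  define H where "H = (\<integral>x. f x * ln (f x) \<partial>\<mu>)"
  have "integrable (density \<mu> f) (\<lambda>x. 1 :: real)" by simp
  then have intf: "integrable \<mu> f"
    using f0 by (subst (asm) integrable_density) auto
  have "(\<integral>x. f x \<partial>\<mu>) = (\<integral>x. 1 \<partial>density \<mu> f)"
    using f0 by (subst integral_density) auto
  then have f1: "(\<integral>x. f x \<partial>\<mu>) = 1" using N.prob_space by simp
  have rho0: "0 \<le> rho t" for t by (simp add: rho_def)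
  have [measurable]: "(\<lambda>x. rho (w x)) \<in> borel_measurable \<mu>" unfolding rho_def by measurable
  have irho: "integrable \<mu> (\<lambda>x. rho (w x))"
    using w rho0 by (intro integrableI_nonneg) (auto simp: le_less_trans[OF w])
  have "ennreal (\<integral>x. rho (w x) \<partial>\<mu>) \<le> 1"
    using nn_integral_eq_integral[OF irho] rho0 w by simp
  then have rho1: "(\<integral>x. rho (w x) \<partial>\<mu>) \<le> 1" by simp
  have w0: "0 \<le> w x" for x using yw[of x] by linarith
  have iew: "integrable \<mu> (\<lambda>x. exp (w x))"
  proof -
    have "integrable \<mu> (\<lambda>x. rho (w x) + 1)" using irho by simp
    then show ?thesis using w0 by (simp add: rho_def)
  qed
  have expw: "1 + w x \<le> exp (w x)" for x using exp_ge_add_one_self[of "w x"] by simp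
  show iy: "integrable \<mu> y"
  proof (rule Bochner_Integration.integrable_bound[OF iew])
    show "AE x in \<mu>. norm (y x) \<le> norm (exp (w x))"
      using yw expw by (intro AE_I2) (smt (verit) exp_gt_zero real_norm_def)
  qed simp
  have ify: "integrable \<mu> (\<lambda>x. f x * y x)"
  proof (rule Bochner_Integration.integrable_bound)
    show "integrable \<mu> (\<lambda>x. f x * ln (f x) - f x + exp (w x))"
      using ent intf iew by simp
    have "\<bar>f x * y x\<bar> \<le> f x * ln (f x) - f x + exp (w x)" for x
    proof -
      have "\<bar>f x * y x\<bar> \<le> f x * w x"
        using f0[of x] yw[of x] by (simp add: abs_mult mult_left_mono)
      then show ?thesis using young_entropy_exp[OF f0[of x], of "w x"] by linarith
    qed
    then show "AE x in \<mu>. norm (f x * y x) \<le> norm (f x * ln (f x) - f x + exp (w x))"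
      by (intro AE_I2) (smt (verit) real_norm_def)
  qed simp
  show "integrable (density \<mu> f) y"
    using ify f0 by (subst integrable_density) auto
  have \<nu>y: "(\<integral>x. y x \<partial>density \<mu> f) = (\<integral>x. f x * y x \<partial>\<mu>)"
    using f0 by (subst integral_density) auto
  \<comment> \<open>The term \<open>- f\<close> in Young's inequality integrates to \<open>- 1\<close> and cancels the constant of the
    exponential series.\<close>
  have bound: "s * ((\<integral>x. f x * y x \<partial>\<mu>) - (\<integral>x. y x \<partial>\<mu>)) \<le> H + s\<^sup>2" if s: "0 < s" "s \<le> 1" for s
  proof -
    have "s * (\<integral>x. f x * y x \<partial>\<mu>) = (\<integral>x. s * (f x * y x) \<partial>\<mu>)" by simp
    also have "\<dots> \<le> (\<integral>x. f x * ln (f x) - f x + (1 + s * y x + s\<^sup>2 * rho (w x)) \<partial>\<mu>)"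
    proof (rule integral_mono)
      fix x
      have "s * (f x * y x) \<le> f x * ln (f x) - f x + exp (s * y x)"
        using young_entropy_exp[OF f0[of x], of "s * y x"] by (simp add: mult.left_commute)
      moreover have "exp (s * y x) \<le> 1 + s * y x + s\<^sup>2 * (exp \<bar>y x\<bar> - 1)"
        using exp_remainder_scaling[of s "y x"] s by linarith
      moreover have "s\<^sup>2 * (exp \<bar>y x\<bar> - 1) \<le> s\<^sup>2 * rho (w x)"
        using yw[of x] w0[of x] by (intro mult_left_mono) (auto simp: rho_def)
      ultimately show "s * (f x * y x)
          \<le> f x * ln (f x) - f x + (1 + s * y x + s\<^sup>2 * rho (w x))" by linarith
    qed (use ify ent intf iy irho in auto)
    also have "\<dots> = H + s * (\<integral>x. y x \<partial>\<mu>) + s\<^sup>2 * (\<integral>x. rho (w x) \<partial>\<mu>)"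
      using ent intf iy irho f1 M.prob_space by (simp add: H_def)
    also have "\<dots> \<le> H + s * (\<integral>x. y x \<partial>\<mu>) + s\<^sup>2 * 1"
      using rho1 by (intro add_left_mono mult_left_mono) auto
    finally show ?thesis by (simp add: algebra_simps)
  qed
  have "(\<integral>x. f x - 1 \<partial>\<mu>) \<le> H"
    unfolding H_def using ent intf young_entropy_exp[OF f0, of _ 0]
    by (intro integral_mono) (auto simp: algebra_simps)
  then have "0 \<le> H" using intf f1 M.prob_space by simp
  then show "(\<integral>x. y x \<partial>density \<mu> f) - (\<integral>x. y x \<partial>\<mu>)
      \<le> 2 * sqrt (\<integral>x. f x * ln (f x) \<partial>\<mu>) + (\<integral>x. f x * ln (f x) \<partial>\<mu>)"
    unfolding \<nu>y H_def[symmetric] by (rule optimise_scaling_parameter) (use bound in auto)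
qed


section \<open>The Luxemburg norm\<close>

text \<open>If \<open>K\<close> is the given exponential moment, scaling \<open>a * chi\<close> by \<open>t\<close> brings the integral of \<open>rho\<close> below
  \<open>t * K\<close>, so \<open>t = 1 / (K + 1)\<close> makes \<open>b = 1 / (t * a)\<close> admissible.\<close>

lemma exp_integrable_imp_rho_norm_finite:
  assumes [measurable]: "chi \<in> borel_measurable \<mu>" and chi0: "\<And>x. 0 \<le> chi x"
    and a: "a > 0" and fin: "(\<integral>\<^sup>+ x. ennreal (exp (a * chi x)) \<partial>\<mu>) < \<infinity>"
  shows "rho_norm \<mu> chi < \<infinity>"
proof -
  obtain K where K: "0 \<le> K" "(\<integral>\<^sup>+ x. ennreal (exp (a * chi x)) \<partial>\<mu>) = ennreal K"
    using fin by (cases "\<integral>\<^sup>+ x. ennreal (exp (a * chi x)) \<partial>\<mu>") auto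
  define t where "t = 1 / (K + 1)"
  have t: "0 < t" "t \<le> 1" using K by (auto simp: t_def)
  define b where "b = 1 / (t * a)"
  have b: "b > 0" using t a by (simp add: b_def)
  have "rho (chi x / b) \<le> t * exp (a * chi x)" for x
  proof -
    have "rho (chi x / b) = exp (t * (a * chi x)) - 1"
      using b t a chi0[of x] by (simp add: rho_def b_def algebra_simps)
    also have "\<dots> \<le> t * exp (a * chi x)"
      using exp_minus_one_scaling[of t "a * chi x"] t by (simp add: algebra_simps)
    finally show ?thesis .
  qed
  then have "(\<integral>\<^sup>+ x. ennreal (rho (chi x / b)) \<partial>\<mu>) \<le> (\<integral>\<^sup>+ x. ennreal t * ennreal (exp (a * chi x)) \<partial>\<mu>)"
    using t by (intro nn_integral_mono) (simp add: ennreal_mult[symmetric] ennreal_leI)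
  also have "\<dots> = ennreal (t * K)"
    using K t by (simp add: nn_integral_cmult ennreal_mult)
  also have "\<dots> \<le> 1" using K by (simp add: t_def)
  finally have "rho_norm \<mu> chi \<le> ereal b"
    unfolding rho_norm_def using b by (intro INF_lower) auto
  then show ?thesis by (rule le_less_trans) simp
qed

lemma rho_norm_finiteE:
  assumes "rho_norm \<mu> chi < \<infinity>"
  obtains b where "0 < b" "(\<integral>\<^sup>+ x. ennreal (rho (chi x / b)) \<partial>\<mu>) \<le> 1"
  using assms unfolding rho_norm_def INF_less_iff by blast

text \<open>Bounds valid for each admissible \<open>b\<close> pass to the infimum. Dividing by \<open>c\<close> does this for
  \<open>c > 0\<close>. For \<open>c = 0\<close> some admissible \<open>b\<close> is needed to get \<open>r \<le> 0\<close>, and finiteness of the norm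
  provides it.\<close>

lemma le_rho_norm_mult:
  assumes c: "0 \<le> c" and fin: "rho_norm \<mu> chi < \<infinity>"
    and bound: "\<And>b. 0 < b \<Longrightarrow> (\<integral>\<^sup>+ x. ennreal (rho (chi x / b)) \<partial>\<mu>) \<le> 1 \<Longrightarrow> r \<le> b * c"
  shows "ereal r \<le> rho_norm \<mu> chi * ereal c"
proof -
  obtain b where b: "0 < b" "(\<integral>\<^sup>+ x. ennreal (rho (chi x / b)) \<partial>\<mu>) \<le> 1"
    using fin by (rule rho_norm_finiteE)
  show ?thesis
  proof (cases "c = 0")
    case True
    then show ?thesis using bound[OF b] by (simp add: zero_ereal_def[symmetric])
  next
    case False
    then have c: "c > 0" using c by simp
    have "ereal (r / c) \<le> rho_norm \<mu> chi"
      unfolding rho_norm_def using bound c by (intro INF_greatest) (auto simp: field_simps)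
    then have "ereal (r / c) * ereal c \<le> rho_norm \<mu> chi * ereal c"
      using c by (intro ereal_mult_right_mono) auto
    then show ?thesis using c by simp
  qed
qed


section \<open>The weighted Pinsker inequality\<close>

theorem corollary3p24:
  fixes \<mu> :: "'a::polish_space measure" and chi :: "'a \<Rightarrow> real"
  assumes "prob_space \<mu>" and "sets \<mu> = sets borel"
    and "chi \<in> borel_measurable borel" and "\<And>x. 0 \<le> chi x"
    and "\<exists>a>0. (\<integral>\<^sup>+ x. ennreal (exp (a * chi x)) \<partial>\<mu>) < \<infinity>"
  shows "rho_norm \<mu> chi < \<infinity> \<and>
    (\<forall>\<nu>. prob_space \<nu> \<longrightarrow> sets \<nu> = sets borel \<longrightarrow> absolutely_continuous \<mu> \<nu> \<longrightarrow>
       density_of \<nu> \<mu> \<in> L_rho_star \<mu> \<longrightarrow>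
       weighted_tv_well_defined chi \<nu> \<mu> \<and>
       weighted_tv_norm chi \<nu> \<mu> < \<infinity> \<and>
       weighted_tv_norm chi \<nu> \<mu> \<le>
         rho_norm \<mu> chi * (2 * ereal_sqrt (rel_entropy \<nu> \<mu>) + rel_entropy \<nu> \<mu>))"
proof (rule conjI)
  have meas: "g \<in> borel_measurable \<mu>" if "g \<in> borel_measurable borel" for g :: "'a \<Rightarrow> real"
    using that assms(2) by (simp cong: measurable_cong_sets)
  show fin: "rho_norm \<mu> chi < \<infinity>"
    using assms exp_integrable_imp_rho_norm_finite[OF meas[OF assms(3)]] by blast
  show "\<forall>\<nu>. prob_space \<nu> \<longrightarrow> sets \<nu> = sets borel \<longrightarrow> absolutely_continuous \<mu> \<nu> \<longrightarrow>
       density_of \<nu> \<mu> \<in> L_rho_star \<mu> \<longrightarrow>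
       weighted_tv_well_defined chi \<nu> \<mu> \<and>
       weighted_tv_norm chi \<nu> \<mu> < \<infinity> \<and>
       weighted_tv_norm chi \<nu> \<mu> \<le>
         rho_norm \<mu> chi * (2 * ereal_sqrt (rel_entropy \<nu> \<mu>) + rel_entropy \<nu> \<mu>)"
  proof (intro allI impI)
    fix \<nu> :: "'a measure"
    assume \<nu>: "prob_space \<nu>" "sets \<nu> = sets borel" and ac: "absolutely_continuous \<mu> \<nu>"
      and L: "density_of \<nu> \<mu> \<in> L_rho_star \<mu>"
    interpret N: prob_space \<nu> by fact
    define f where "f = density_of \<nu> \<mu>"
    have f0: "0 \<le> f x" for x by (simp add: f_def density_of_def)
    have fm [measurable]: "f \<in> borel_measurable \<mu>"
      using L by (simp add: f_def L_rho_star_def)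
    have \<nu>f: "density \<mu> f = \<nu>"
      using density_density_of[OF assms(1) \<nu>(1) _ ac] \<nu>(2) assms(2) by (simp add: f_def)
    have "integrable (density \<mu> f) (\<lambda>x. 1 :: real)" by (simp add: \<nu>f)
    then have "integrable \<mu> f"
      using f0 by (subst (asm) integrable_density) auto
    then have ent: "integrable \<mu> (\<lambda>x. f x * ln (f x))"
      using L_rho_star_imp_integrable_entropy[OF assms(1) f0] L by (simp add: f_def)
    define H where "H = (\<integral>x. f x * ln (f x) \<partial>\<mu>)"
    have "integrable (density \<mu> f) (\<lambda>x. ln (f x))"
      using ent f0 by (subst integrable_density) auto
    moreover have "(\<integral>x. ln (f x) \<partial>density \<mu> f) = H"
      unfolding H_def using f0 by (subst integral_density) auto
    ultimately have relH: "rel_entropy \<nu> \<mu> = ereal H"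
      using ac ext_integral_eq_integral[of \<nu> "\<lambda>x. ln (f x)"] unfolding \<nu>f
      by (simp add: rel_entropy_def f_def)
    define c where "c = 2 * sqrt H + H"
    have rhs: "2 * ereal_sqrt (rel_entropy \<nu> \<mu>) + rel_entropy \<nu> \<mu> = ereal c"
      by (simp add: relH c_def ereal_sqrt_def)

    have test:
      "integrable \<mu> (\<lambda>x. chi x * \<psi> x) \<and> integrable \<nu> (\<lambda>x. chi x * \<psi> x) \<and>
       (\<integral>x. chi x * \<psi> x \<partial>\<nu>) - (\<integral>x. chi x * \<psi> x \<partial>\<mu>) \<le> b * c"
      if \<psi>: "\<psi> \<in> unit_test_functions" and b: "0 < b" "(\<integral>\<^sup>+ x. ennreal (rho (chi x / b)) \<partial>\<mu>) \<le> 1"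
      for \<psi> b
    proof -
      have [measurable]: "\<psi> \<in> borel_measurable \<mu>" "chi \<in> borel_measurable \<mu>"
        using \<psi> by (auto intro!: meas assms(3) simp only: unit_test_functions_def mem_Collect_eq)
      have \<psi>1: "\<bar>\<psi> x\<bar> \<le> 1" for x using \<psi> by (simp add: unit_test_functions_def)
      let ?y = "\<lambda>x. chi x * \<psi> x / b"
      have yw: "\<bar>?y x\<bar> \<le> chi x / b" for x
      proof -
        have "\<bar>chi x * \<psi> x\<bar> \<le> chi x"
          unfolding abs_mult using mult_left_le[OF \<psi>1[of x] assms(4)[of x]] assms(4)[of x] by simp
        then show ?thesis using b(1) by (simp add: divide_right_mono)
      qed
      have p: "prob_space (density \<mu> f)" using \<nu> \<nu>f by simp
      have m: "(\<lambda>x. chi x / b) \<in> borel_measurable \<mu>" "?y \<in> borel_measurable \<mu>" by measurable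
      note I = integral_difference_le_entropy[where f = f and y = ?y and w = "\<lambda>x. chi x / b",
          OF assms(1) f0 fm p ent m yw b(2), unfolded \<nu>f]
      have int: "integrable \<mu> ?y" "integrable \<nu> ?y"
        using I(1,2) .
      have diff: "(\<integral>x. ?y x \<partial>\<nu>) - (\<integral>x. ?y x \<partial>\<mu>) \<le> c"
        using I(3) by (simp only: c_def H_def)
      have eq: "chi x * \<psi> x = b * ?y x" for x using b(1) by simp
      have "integrable \<mu> (\<lambda>x. b * ?y x)" "integrable \<nu> (\<lambda>x. b * ?y x)"
        using int by (simp_all only: integrable_mult_right)
      then have "integrable \<mu> (\<lambda>x. chi x * \<psi> x)" "integrable \<nu> (\<lambda>x. chi x * \<psi> x)"
        unfolding eq[symmetric] .
      moreover have "(\<integral>x. chi x * \<psi> x \<partial>\<nu>) - (\<integral>x. chi x * \<psi> x \<partial>\<mu>)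
          = b * ((\<integral>x. ?y x \<partial>\<nu>) - (\<integral>x. ?y x \<partial>\<mu>))"
        unfolding right_diff_distrib using b(1) by simp
      ultimately show ?thesis using mult_left_mono[OF diff, of b] b(1) by simp
    qed

    obtain b where b: "0 < b" "(\<integral>\<^sup>+ x. ennreal (rho (chi x / b)) \<partial>\<mu>) \<le> 1"
      using fin by (rule rho_norm_finiteE)
    have "(\<lambda>x. 0) \<in> unit_test_functions" by (simp add: unit_test_functions_def)
    \<comment> \<open>The zero test function turns the bound into \<open>0 \<le> b * c\<close>.\<close>
    from test[OF this b] have c0: "0 \<le> c" using b by (simp add: zero_le_mult_iff)
    have wd: "weighted_tv_well_defined chi \<nu> \<mu>"
      unfolding weighted_tv_well_defined_def using test b by blast
    have le: "weighted_tv_norm chi \<nu> \<mu> \<le> rho_norm \<mu> chi * ereal c"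
      unfolding weighted_tv_norm_def
      by (intro SUP_least le_rho_norm_mult c0 fin) (use test in blast)
    have "weighted_tv_norm chi \<nu> \<mu> \<le> ereal (b * c)"
      unfolding weighted_tv_norm_def by (intro SUP_least) (use test b in auto)
    then have "weighted_tv_norm chi \<nu> \<mu> < \<infinity>" by (rule le_less_trans) simp
    then show "weighted_tv_well_defined chi \<nu> \<mu> \<and> weighted_tv_norm chi \<nu> \<mu> < \<infinity> \<and>
       weighted_tv_norm chi \<nu> \<mu> \<le>
         rho_norm \<mu> chi * (2 * ereal_sqrt (rel_entropy \<nu> \<mu>) + rel_entropy \<nu> \<mu>)"
      using wd le rhs by simp
  qed
qed

end
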